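(* Let $n,p\ge1$ and let $\mathcal{H}\in\mathbb{C}^{2n\times2n\times p}$. Then $\mathcal{H}$ is T-Hamiltonian if and only if each Fourier-domain slice $\widehat{\boldsymbol{H}}^{(i)}$, $i=1,\dots,p$, can be written in the block form $$\widehat{\boldsymbol{H}}^{(i)}=\begin{bmatrix}\boldsymbol{A}_i&\boldsymbol{B}_i\\\boldsymbol{C}_i&-\boldsymbol{A}_i^H\end{bmatrix},$$ where $\boldsymbol{A}_i,\boldsymbol{B}_i,\boldsymbol{C}_i\in\mathbb{C}^{n\times n}$ and the matrices $\boldsymbol{B}_i$ and $\boldsymbol{C}_i$ are Hermitian for each $i=1,\dots,p$.
   Context: A tensor $\mathcal{A}\in\mathbb{C}^{m\times n\times p}$ has frontal slices $\boldsymbol{A}^{(1)},\dots,\boldsymbol{A}^{(p)}\in\mathbb{C}^{m\times n}$. With $\omega=e^{2\pi\sqrt{-1}/p}$, its Fourier-domain slices are $\widehat{\boldsymbol{A}}^{(i)}=\sum_{j=1}^{p}\omega^{(i-1)(j-1)}\boldsymbol{A}^{(j)}$, $i=1,\dots,p$. Let $\operatorname{bcirc}(\mathcal{A})\in\mathbb{C}^{mp\times np}$ be the block circulant matrix whose $(r,s)$ block is $\boldsymbol{A}^{(((r-s)\bmod p)+1)}$. The T-product $\mathcal{A}*\mathcal{B}$ is the tensor with $\operatorname{bcirc}(\mathcal{A}*\mathcal{B})=\operatorname{bcirc}(\mathcal{A})\operatorname{bcirc}(\mathcal{B})$; equivalently, if $\mathcal{C}=\mathcal{A}*\mathcal{B}$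 then $\widehat{\boldsymbol{C}}^{(i)}=\widehat{\boldsymbol{A}}^{(i)}\widehat{\boldsymbol{B}}^{(i)}$ for all $i$. The T-conjugate transpose $\mathcal{A}^H$ has frontal slices $(\boldsymbol{A}^{(1)})^H$ for $k=1$ and $(\boldsymbol{A}^{(p-k+2)})^H$ for $k\ge2$ (so that $\operatorname{bcirc}(\mathcal{A}^H)=\operatorname{bcirc}(\mathcal{A})^H$). Let $\boldsymbol{J}=\begin{bmatrix}\boldsymbol{0}&\boldsymbol{I}_n\\-\boldsymbol{I}_n&\boldsymbol{0}\end{bmatrix}$. The T-symplectic unit tensor $\mathcal{J}\in\mathbb{R}^{2n\times2n\times p}$ is the tensor all of whose Fourier-domain slices equal $\boldsymbol{J}$. A tensor $\mathcal{H}\in\mathbb{C}^{2n\times2n\times p}$ is T-Hamiltonian if $(\mathcal{J}*\mathcal{H})^H=\mathcal{J}*\mathcal{H}$. *)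

theory Defs
  imports Complex_Main "Jordan_Normal_Form.Schur_Decomposition"
begin

text \<open>A tensor in \<open>\<complex>\<^bsup>m\<times>n\<times>p\<^esup>\<close> is the list of its \<open>p\<close> frontal slices. All indices (of slices, of
  Fourier-domain slices and of blocks) start at \<open>0\<close>: the frontal slice written \<open>A\<^bsup>(k)\<^esup>\<close> with
  \<open>1 \<le> k \<le> p\<close> is \<open>A ! (k - 1)\<close>.  The functions below read \<open>m\<close> and \<open>n\<close> off the first slice,
  so they are meaningful only for \<open>p \<ge> 1\<close>.\<close>

type_synonym tensor = "complex mat list"

definition tensor_carrier :: "nat \<Rightarrow> nat \<Rightarrow> nat \<Rightarrow> tensor set" where
  "tensor_carrier m n p = {A. length A = p \<and> set A \<subseteq> carrier_mat m n}"

definition slice_rows :: "tensor \<Rightarrow> nat" where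
  "slice_rows A = dim_row (A ! 0)"

definition slice_cols :: "tensor \<Rightarrow> nat" where
  "slice_cols A = dim_col (A ! 0)"

definition fourier_slice :: "tensor \<Rightarrow> nat \<Rightarrow> complex mat" where
  "fourier_slice A i =
     (let p = length A; \<omega> = exp (2 * of_real pi * \<i> / of_nat p)
      in mat (slice_rows A) (slice_cols A) (\<lambda>(r, c). \<Sum>j<p. \<omega> ^ (i * j) * (A ! j) $$ (r, c)))"

text \<open>Row \<open>r\<close> of the block circulant matrix lies in block row \<open>r div m\<close>, at position \<open>r mod m\<close>
  within it; similarly for columns.  The summand \<open>p\<close> keeps the subtraction of natural numbers
  from truncating.\<close>

definition bcirc :: "tensor \<Rightarrow> complex mat" where
  "bcirc A =
     (let m = slice_rows A; n = slice_cols A; p = length A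
      in mat (m * p) (n * p)
           (\<lambda>(r, c). (A ! ((r div m + p - c div n) mod p)) $$ (r mod m, c mod n)))"

definition t_product :: "tensor \<Rightarrow> tensor \<Rightarrow> tensor" (infixl "*\<^sub>T" 70) where
  "A *\<^sub>T B =
     (THE C. C \<in> tensor_carrier (slice_rows A) (slice_cols B) (length A) \<and>
             bcirc C = bcirc A * bcirc B)"

definition t_adjoint :: "tensor \<Rightarrow> tensor" where
  "t_adjoint A =
     map (\<lambda>k. mat_adjoint (if k = 0 then A ! 0 else A ! (length A - k))) [0..<length A]"

definition J_mat :: "nat \<Rightarrow> complex mat" where
  "J_mat n = four_block_mat (0\<^sub>m n n) (1\<^sub>m n) (- 1\<^sub>m n) (0\<^sub>m n n)"

definition J_tensor :: "nat \<Rightarrow> nat \<Rightarrow> tensor" where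
  "J_tensor n p =
     (THE T. T \<in> tensor_carrier (2 * n) (2 * n) p \<and> (\<forall>i<p. fourier_slice T i = J_mat n))"

definition T_Hamiltonian :: "nat \<Rightarrow> nat \<Rightarrow> tensor \<Rightarrow> bool" where
  "T_Hamiltonian n p H \<longleftrightarrow>
     H \<in> tensor_carrier (2 * n) (2 * n) p \<and>
     t_adjoint (J_tensor n p *\<^sub>T H) = J_tensor n p *\<^sub>T H"

definition hermitian_mat :: "complex mat \<Rightarrow> bool" where
  "hermitian_mat A \<longleftrightarrow> mat_adjoint A = A"


text \<open>The remaining lemmas show that the two definite descriptions above are well defined.  The
  explicit form \<open>J_tensor_eq\<close> also shows that \<open>J_tensor\<close> is a real tensor.\<close>

lemma tensor_carrierD:
  assumes "A \<in> tensor_carrier m n p"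
  shows "length A = p" "k < p \<Longrightarrow> A ! k \<in> carrier_mat m n"
    "k < p \<Longrightarrow> dim_row (A ! k) = m" "k < p \<Longrightarrow> dim_col (A ! k) = n"
    "p \<ge> 1 \<Longrightarrow> slice_rows A = m" "p \<ge> 1 \<Longrightarrow> slice_cols A = n"
proof -
  show len: "length A = p" using assms by (simp add: tensor_carrier_def)
  show car: "A ! k \<in> carrier_mat m n" if "k < p" for k
    using assms that len nth_mem[of k A] unfolding tensor_carrier_def by blast
  show "k < p \<Longrightarrow> dim_row (A ! k) = m" "k < p \<Longrightarrow> dim_col (A ! k) = n"
    using car by auto
  show "p \<ge> 1 \<Longrightarrow> slice_rows A = m" "p \<ge> 1 \<Longrightarrow> slice_cols A = n"
    using car[of 0] by (auto simp: slice_rows_def slice_cols_def)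
qed

lemma tensor_eqI:
  assumes "A \<in> tensor_carrier m n p" "B \<in> tensor_carrier m n p"
    and "\<And>k i j. k < p \<Longrightarrow> i < m \<Longrightarrow> j < n \<Longrightarrow> (A ! k) $$ (i, j) = (B ! k) $$ (i, j)"
  shows "A = B"
proof (rule nth_equalityI)
  show "length A = length B"
    using tensor_carrierD(1)[OF assms(1)] tensor_carrierD(1)[OF assms(2)] by simp
  fix k assume "k < length A"
  then have k: "k < p" using tensor_carrierD(1)[OF assms(1)] by simp
  show "A ! k = B ! k"
    using assms(3)[OF k] tensor_carrierD(2)[OF assms(1) k] tensor_carrierD(2)[OF assms(2) k]
    by (intro eq_matI) auto
qed

lemma bcirc_inj:
  assumes p: "p \<ge> 1" and A: "A \<in> tensor_carrier m n p" and B: "B \<in> tensor_carrier m n p"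
    and eq: "bcirc A = bcirc B"
  shows "A = B"
proof (rule tensor_eqI[OF A B])
  fix k i j assume k: "k < p" and i: "i < m" and j: "j < n"
  have "k * m + i < Suc k * m" using i by simp
  also have "\<dots> \<le> m * p" using k by (metis Suc_leI mult.commute mult_le_mono1)
  finally have r: "k * m + i < m * p" .
  have c: "j < n * p" using j p by (metis less_le_trans mult.right_neutral mult_le_mono2)
  have "bcirc X $$ (k * m + i, j) = (X ! k) $$ (i, j)" if X: "X \<in> tensor_carrier m n p" for X
    using r c i j k tensor_carrierD[OF X] p by (simp add: bcirc_def Let_def)
  then show "(A ! k) $$ (i, j) = (B ! k) $$ (i, j)" using eq A B by metis
qed

lemma bij_betw_shift_mod:
  fixes p S :: nat
  assumes "S < p"
  shows "bij_betw (\<lambda>L. (L + p - S) mod p) {..<p} {..<p}"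
proof (rule bij_betw_byWitness[where f' = "\<lambda>l. (l + S) mod p"])
  show "\<forall>a\<in>{..<p}. ((a + p - S) mod p + S) mod p = a"
    using assms by (auto simp: mod_add_left_eq)
  have "((a + S) mod p + p - S) mod p = a" if "a < p" for a
    using assms that by (cases "a + S < p") (auto simp: le_mod_geq)
  then show "\<forall>a\<in>{..<p}. ((a + S) mod p + p - S) mod p = a" by simp
qed (use assms in auto)

lemma shift_mod_diff:
  fixes p R S L :: nat
  assumes "R < p" "S < p" "L < p"
  shows "((R + p - S) mod p + p - (L + p - S) mod p) mod p = (R + p - L) mod p"
proof -
  have e: "(x + p - y) mod p = (if y \<le> x then x - y else x + p - y)" if "x < p" "y < p" for x y
    using that by (auto simp: le_mod_geq)
  show ?thesis
    using assms by (subst (1 2 4) e) (auto simp: e)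
qed

lemma t_product_ex1:
  assumes p: "p \<ge> 1" and A: "A \<in> tensor_carrier m n p" and B: "B \<in> tensor_carrier n q p"
  shows "\<exists>!C. C \<in> tensor_carrier m q p \<and> bcirc C = bcirc A * bcirc B"
proof -
  define C where "C = map (\<lambda>k. mat m q (\<lambda>(i, j).
    \<Sum>l<p. \<Sum>t<n. (A ! ((k + p - l) mod p)) $$ (i, t) * (B ! l) $$ (t, j))) [0..<p]"
  have C: "C \<in> tensor_carrier m q p" by (auto simp: C_def tensor_carrier_def)
  note dA = tensor_carrierD[OF A] and dB = tensor_carrierD[OF B] and dC = tensor_carrierD[OF C]
  have "bcirc C = bcirc A * bcirc B"
  proof (rule eq_matI)
    fix r c assume "r < dim_row (bcirc A * bcirc B)" "c < dim_col (bcirc A * bcirc B)"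
    then have r: "r < m * p" and c: "c < q * p"
      using dA dB p by (auto simp: bcirc_def Let_def)
    define R S where "R = r div m" and "S = c div q"
    have m: "m > 0" "q > 0" using r c by (auto intro: Nat.gr0I)
    have R: "R < p" and S: "S < p"
      using r c by (auto simp: R_def S_def less_mult_imp_div_less mult.commute)
    let ?a = "\<lambda>k t. (A ! k) $$ (r mod m, t)" and ?b = "\<lambda>k t. (B ! k) $$ (t, c mod q)"
    let ?f = "\<lambda>x. ?a ((R + p - x div n) mod p) (x mod n) * ?b ((x div n + p - S) mod p) (x mod n)"
    have "(bcirc A * bcirc B) $$ (r, c) = (\<Sum>x<n * p. ?f x)"
      using r c dA dB p
      by (simp add: bcirc_def Let_def scalar_prod_def R_def S_def atLeast0LessThan)
    also have "\<dots> = (\<Sum>L<p. \<Sum>x = L * n..<L * n + n. ?f x)"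
      by (simp add: sum.nat_group mult.commute)
    also have "\<dots> = (\<Sum>L<p. \<Sum>t<n. ?f (L * n + t))"
    proof (rule sum.cong[OF refl])
      fix L
      show "(\<Sum>x = L * n..<L * n + n. ?f x) = (\<Sum>t<n. ?f (L * n + t))"
        using sum.shift_bounds_nat_ivl[of ?f 0 "L * n" n] by (simp add: atLeast0LessThan add.commute)
    qed
    also have "\<dots> = (\<Sum>L<p. \<Sum>t<n. ?a ((R + p - L) mod p) t * ?b ((L + p - S) mod p) t)"
    proof (rule sum.cong[OF refl], rule sum.cong[OF refl])
      fix L t assume "t \<in> {..<n}"
      then have "(L * n + t) div n = L" "(L * n + t) mod n = t" by auto
      then show "?f (L * n + t) = ?a ((R + p - L) mod p) t * ?b ((L + p - S) mod p) t"
        by (simp only:)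
    qed
    also have "\<dots> = (\<Sum>L<p. \<Sum>t<n. ?a (((R + p - S) mod p + p - (L + p - S) mod p) mod p) t
                                    * ?b ((L + p - S) mod p) t)"
      by (rule sum.cong[OF refl]) (simp only: lessThan_iff shift_mod_diff[OF R S])
    also have "\<dots> = (\<Sum>l<p. \<Sum>t<n. ?a (((R + p - S) mod p + p - l) mod p) t * ?b l t)"
      by (rule sum.reindex_bij_betw[OF bij_betw_shift_mod[OF S]])
    also have "\<dots> = (C ! ((R + p - S) mod p)) $$ (r mod m, c mod q)"
      using p m by (simp add: C_def)
    also have "\<dots> = bcirc C $$ (r, c)"
      using r c dC p by (simp add: bcirc_def Let_def R_def S_def)
    finally show "bcirc C $$ (r, c) = (bcirc A * bcirc B) $$ (r, c)" by simp
  qed (use dA dB dC p in \<open>auto simp: bcirc_def Let_def\<close>)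
  note eq = this
  show ?thesis
  proof (rule ex1I[of _ C])
    fix D assume "D \<in> tensor_carrier m q p \<and> bcirc D = bcirc A * bcirc B"
    then show "D = C" using bcirc_inj[OF p _ C, of D] eq by simp
  qed (use C eq in simp)
qed

lemma sum_root_unity_powers:
  assumes "j < p" "k < p"
  defines "\<omega> \<equiv> exp (2 * of_real pi * \<i> / of_nat p)"
  shows "(\<Sum>i<p. \<omega> ^ (i * (p - k)) * \<omega> ^ (i * j)) = (if j = k then of_nat p else 0)"
proof -
  have p: "p > 0" using assms by simp
  have pw: "\<omega> ^ d = cis (2 * pi * real d / real p)" for d
    using p by (simp add: \<omega>_def cis_conv_exp exp_of_nat_mult[symmetric] field_simps)
  have wp: "\<omega> ^ p = 1" using p by (simp add: pw)
  define z where "z = \<omega> ^ (p - k + j)"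
  have "(\<Sum>i<p. \<omega> ^ (i * (p - k)) * \<omega> ^ (i * j)) = (\<Sum>i<p. z ^ i)"
    by (intro sum.cong refl) (simp add: z_def power_add power_mult[symmetric] algebra_simps)
  also have "\<dots> = (if j = k then of_nat p else 0)"
  proof (cases "j = k")
    case True
    then have "z = 1" using assms(2) wp by (simp add: z_def)
    with True show ?thesis by simp
  next
    case False
    have "\<omega> ^ j \<noteq> \<omega> ^ k"
      using False bij_betw_roots_unity[OF p] assms(1,2) unfolding pw bij_betw_def inj_on_def
      by auto
    moreover have "z * \<omega> ^ k = \<omega> ^ j"
      using assms(2) wp by (simp add: z_def power_add[symmetric])
         (simp add: power_add)
    ultimately have "z \<noteq> 1" by auto
    moreover have "z ^ p = 1"
      using wp by (simp add: z_def power_mult[symmetric] mult.commute[of _ p])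
         (simp add: power_mult)
    ultimately show ?thesis using False by (simp add: sum_gp_strict geometric_sum)
  qed
  finally show ?thesis .
qed

lemma fourier_slice_inj:
  assumes p: "p \<ge> 1" and A: "A \<in> tensor_carrier m n p" and B: "B \<in> tensor_carrier m n p"
    and eq: "\<And>i. i < p \<Longrightarrow> fourier_slice A i = fourier_slice B i"
  shows "A = B"
proof (rule tensor_eqI[OF A B])
  fix k r c assume k: "k < p" and r: "r < m" and c: "c < n"
  define \<omega> :: complex where "\<omega> = exp (2 * of_real pi * \<i> / of_nat p)"
  have inv: "(\<Sum>i<p. \<omega> ^ (i * (p - k)) * fourier_slice X i $$ (r, c)) = of_nat p * (X ! k) $$ (r, c)"
    if X: "X \<in> tensor_carrier m n p" for X
  proof -
    have "(\<Sum>i<p. \<omega> ^ (i * (p - k)) * fourier_slice X i $$ (r, c))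
        = (\<Sum>i<p. \<Sum>j<p. \<omega> ^ (i * (p - k)) * \<omega> ^ (i * j) * (X ! j) $$ (r, c))"
      using r c tensor_carrierD[OF X] p
      by (simp add: fourier_slice_def Let_def \<omega>_def sum_distrib_left mult.assoc)
    also have "\<dots> = (\<Sum>j<p. (\<Sum>i<p. \<omega> ^ (i * (p - k)) * \<omega> ^ (i * j)) * (X ! j) $$ (r, c))"
      by (subst sum.swap) (simp add: sum_distrib_right)
    also have "\<dots> = (\<Sum>j<p. if j = k then of_nat p * (X ! j) $$ (r, c) else 0)"
      using k by (intro sum.cong refl) (simp add: \<omega>_def sum_root_unity_powers)
    also have "\<dots> = of_nat p * (X ! k) $$ (r, c)"
      using k by simp
    finally show ?thesis .
  qed
  have "of_nat p * (A ! k) $$ (r, c) = of_nat p * (B ! k) $$ (r, c)"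
    unfolding inv[OF A, symmetric] inv[OF B, symmetric] using eq by simp
  then show "(A ! k) $$ (r, c) = (B ! k) $$ (r, c)" using p by simp
qed

lemma J_tensor_ex1:
  assumes p: "p \<ge> 1"
  shows "\<exists>!T. T \<in> tensor_carrier (2 * n) (2 * n) p \<and> (\<forall>i<p. fourier_slice T i = J_mat n)"
    and J_tensor_eq: "J_tensor n p = J_mat n # replicate (p - 1) (0\<^sub>m (2 * n) (2 * n))"
proof -
  let ?T = "J_mat n # replicate (p - 1) (0\<^sub>m (2 * n) (2 * n))"
  have J: "J_mat n \<in> carrier_mat (2 * n) (2 * n)" unfolding J_mat_def
    using four_block_carrier_mat[of "0\<^sub>m n n" n n "0\<^sub>m n n" n n] by (simp add: mult_2)
  have T: "?T \<in> tensor_carrier (2 * n) (2 * n) p"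
    using J p by (auto simp: tensor_carrier_def)
  have F: "fourier_slice ?T i = J_mat n" for i
  proof (rule eq_matI)
    fix r c assume "r < dim_row (J_mat n)" "c < dim_col (J_mat n)"
    then have rc: "r < 2 * n" "c < 2 * n" using J by auto
    have "fourier_slice ?T i $$ (r, c)
        = (\<Sum>j<p. exp (2 * of_real pi * \<i> / of_nat p) ^ (i * j) * (?T ! j) $$ (r, c))"
      using rc tensor_carrierD(1,5,6)[OF T] p by (simp add: fourier_slice_def Let_def)
    also have "\<dots> = (\<Sum>j<p. if j = 0 then J_mat n $$ (r, c) else 0)"
      using rc by (intro sum.cong refl) (auto simp: nth_Cons')
    also have "\<dots> = J_mat n $$ (r, c)" using p by simp
    finally show "fourier_slice ?T i $$ (r, c) = J_mat n $$ (r, c)" .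
  qed (use J in \<open>auto simp: fourier_slice_def Let_def slice_rows_def slice_cols_def\<close>)
  have uniq: "S = ?T" if "S \<in> tensor_carrier (2 * n) (2 * n) p \<and> (\<forall>i<p. fourier_slice S i = J_mat n)"
    for S
    by (rule fourier_slice_inj[OF p]) (use that T F in auto)
  show "\<exists>!T. T \<in> tensor_carrier (2 * n) (2 * n) p \<and> (\<forall>i<p. fourier_slice T i = J_mat n)"
    by (rule ex1I[of _ ?T]) (use T F uniq in auto)
  show "J_tensor n p = ?T"
    unfolding J_tensor_def by (rule the_equality) (use T F uniq in auto)
qed

end

theory Submission
  imports Defs
begin

text \<open>Only the first slice of the T-symplectic unit is nonzero, so multiplying by it multiplies each
  frontal slice, hence each Fourier-domain slice, by \<open>J\<close>.  The T-conjugate transpose becomes the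
  conjugate transpose on each Fourier-domain slice, and the Fourier transform is injective.  So a
  tensor is T-Hamiltonian iff every Fourier-domain slice \<open>X\<close> makes \<open>J X\<close> Hermitian, which is read
  off the four blocks of \<open>X\<close>.\<close>

section \<open>Adjoints and four-block matrices\<close>

lemma index_mat_adjoint:
  assumes "r < dim_col A" "c < dim_row A"
  shows "mat_adjoint A $$ (r, c) = conjugate (A $$ (c, r))"
  using assms by (simp add: mat_adjoint_def mat_of_rows_index)

lemma mat_adjoint_carrier:
  assumes "A \<in> carrier_mat m n"
  shows "mat_adjoint A \<in> carrier_mat n m"
  using assms by (auto simp: mat_adjoint_def)

lemma dim_mat_adjoint: "dim_row (mat_adjoint A) = dim_col A" "dim_col (mat_adjoint A) = dim_row A"
  by (auto simp: mat_adjoint_def)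

lemma mat_adjoint_mat_adjoint: "mat_adjoint (mat_adjoint A) = (A :: complex mat)"
  by (rule eq_matI) (auto simp: index_mat_adjoint dim_mat_adjoint)

lemma mat_adjoint_uminus: "mat_adjoint (- A) = - mat_adjoint (A :: complex mat)"
  by (rule eq_matI) (auto simp: index_mat_adjoint dim_mat_adjoint)

lemma mat_adjoint_four_block:
  assumes "A \<in> carrier_mat k l" "B \<in> carrier_mat k n" "C \<in> carrier_mat m l" "D \<in> carrier_mat m n"
  shows "mat_adjoint (four_block_mat A B C D) =
    four_block_mat (mat_adjoint A) (mat_adjoint C) (mat_adjoint B) (mat_adjoint D)"
  by (rule eq_matI) (use assms in \<open>auto simp: index_mat_adjoint dim_mat_adjoint\<close>)

text \<open>With the block sizes fixed in common, each block can be read back from the large matrix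
  at indices shifted by \<open>k\<close> or \<open>l\<close>. This turns an equation between block
  matrices into four smaller ones.\<close>

lemma four_block_mat_eq_iff:
  assumes "A \<in> carrier_mat k l" "B \<in> carrier_mat k n" "C \<in> carrier_mat m l" "D \<in> carrier_mat m n"
    and "A' \<in> carrier_mat k l" "B' \<in> carrier_mat k n" "C' \<in> carrier_mat m l" "D' \<in> carrier_mat m n"
  shows "four_block_mat A B C D = four_block_mat A' B' C' D' \<longleftrightarrow>
    A = A' \<and> B = B' \<and> C = C' \<and> D = D'"
proof
  assume eq: "four_block_mat A B C D = four_block_mat A' B' C' D'"
  have e: "four_block_mat A B C D $$ (i, j) = four_block_mat A' B' C' D' $$ (i, j)" for i j
    using eq by simp
  have "A = A'"
  proof (rule eq_matI)
    fix i j assume "i < dim_row A'" "j < dim_col A'"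
    then show "A $$ (i, j) = A' $$ (i, j)" using e[of i j] assms by simp
  qed (use assms in auto)
  moreover have "B = B'"
  proof (rule eq_matI)
    fix i j assume "i < dim_row B'" "j < dim_col B'"
    then show "B $$ (i, j) = B' $$ (i, j)" using e[of i "l + j"] assms by simp
  qed (use assms in auto)
  moreover have "C = C'"
  proof (rule eq_matI)
    fix i j assume "i < dim_row C'" "j < dim_col C'"
    then show "C $$ (i, j) = C' $$ (i, j)" using e[of "k + i" j] assms by simp
  qed (use assms in auto)
  moreover have "D = D'"
  proof (rule eq_matI)
    fix i j assume "i < dim_row D'" "j < dim_col D'"
    then show "D $$ (i, j) = D' $$ (i, j)" using e[of "k + i" "l + j"] assms by simp
  qed (use assms in auto)
  ultimately show "A = A' \<and> B = B' \<and> C = C' \<and> D = D'" by simp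
qed simp

section \<open>The Hermitian condition on \<open>J X\<close> in terms of the blocks of
  \<open>X\<close>\<close>

lemma J_mat_carrier: "J_mat n \<in> carrier_mat (2 * n) (2 * n)"
  unfolding J_mat_def
  using four_block_carrier_mat[of "0\<^sub>m n n" n n "0\<^sub>m n n" n n] by (simp add: mult_2)

lemma J_mat_mult_four_block:
  assumes "A \<in> carrier_mat n n" "B \<in> carrier_mat n n" "C \<in> carrier_mat n n" "D \<in> carrier_mat n n"
  shows "J_mat n * four_block_mat A B C D = four_block_mat C D (- A) (- B)"
  unfolding J_mat_def using assms
  by (subst mult_four_block_mat[where ?nr1.0 = n and ?n1.0 = n and ?n2.0 = n and ?nr2.0 = n
        and ?nc1.0 = n and ?nc2.0 = n]) auto

text \<open>The product has blocks \<open>C\<close>, \<open>D\<close>, \<open>- A\<close>,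
  \<open>- B\<close>. In the comparison with its adjoint, the diagonal blocks ask that
  \<open>C\<close> and \<open>B\<close> be Hermitian, while the two off-diagonal equations are
  adjoints of one another and determine \<open>D\<close>.\<close>

lemma hermitian_J_mat_mult_four_block:
  assumes "A \<in> carrier_mat n n" "B \<in> carrier_mat n n" "C \<in> carrier_mat n n" "D \<in> carrier_mat n n"
  shows "hermitian_mat (J_mat n * four_block_mat A B C D) \<longleftrightarrow>
    hermitian_mat B \<and> hermitian_mat C \<and> D = - mat_adjoint A"
proof -
  note adj = assms[THEN mat_adjoint_carrier]
  have "mat_adjoint (four_block_mat C D (- A) (- B)) =
      four_block_mat (mat_adjoint C) (- mat_adjoint A) (mat_adjoint D) (- mat_adjoint B)"
    using assms by (subst mat_adjoint_four_block[of _ n n _ n _ n]) (auto simp: mat_adjoint_uminus)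
  then have "hermitian_mat (J_mat n * four_block_mat A B C D) \<longleftrightarrow>
      mat_adjoint C = C \<and> - mat_adjoint A = D \<and> mat_adjoint D = - A \<and> - mat_adjoint B = - B"
    unfolding hermitian_mat_def J_mat_mult_four_block[OF assms] using assms adj
    by (simp add: four_block_mat_eq_iff[of _ n n _ n _ n])
  also have "- mat_adjoint B = - B \<longleftrightarrow> mat_adjoint B = B"
    by (metis uminus_uminus_mat)
  \<comment> \<open>The adjoint is an involution that commutes with negation, so
    \<open>mat_adjoint D = - A\<close> already follows from
    \<open>- mat_adjoint A = D\<close>.\<close>
  also have "mat_adjoint C = C \<and> - mat_adjoint A = D \<and> mat_adjoint D = - A \<and> mat_adjoint B = B \<longleftrightarrow>
      mat_adjoint C = C \<and> - mat_adjoint A = D \<and> mat_adjoint B = B"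
    by (auto simp: mat_adjoint_uminus mat_adjoint_mat_adjoint)
  finally show ?thesis unfolding hermitian_mat_def by auto
qed

lemma hermitian_J_mat_mult_iff:
  assumes X: "X \<in> carrier_mat (2 * n) (2 * n)"
  shows "hermitian_mat (J_mat n * X) \<longleftrightarrow>
    (\<exists>A B C. A \<in> carrier_mat n n \<and> B \<in> carrier_mat n n \<and> C \<in> carrier_mat n n \<and>
        hermitian_mat B \<and> hermitian_mat C \<and> X = four_block_mat A B C (- mat_adjoint A))"
    (is "?L \<longleftrightarrow> ?R")
proof
  assume L: ?L
  obtain A B C D where "split_block X n n = (A, B, C, D)" by (metis prod_cases4)
  with X have c: "A \<in> carrier_mat n n" "B \<in> carrier_mat n n" "C \<in> carrier_mat n n"
      "D \<in> carrier_mat n n" "X = four_block_mat A B C D"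
    using split_block[of X n n A B C D n n] by (auto simp: mult_2)
  then show ?R using L hermitian_J_mat_mult_four_block[OF c(1-4)] by blast
next
  assume ?R
  then show ?L
    using hermitian_J_mat_mult_four_block mat_adjoint_carrier uminus_carrier_mat by metis
qed

section \<open>T-product with a tensor supported on its first slice\<close>

lemma t_product_single_slice:
  assumes p: "p \<ge> 1" and M: "M \<in> carrier_mat m n" and B: "B \<in> tensor_carrier n q p"
  shows "(M # replicate (p - 1) (0\<^sub>m m n)) *\<^sub>T B = map ((*) M) B"
proof -
  let ?A = "M # replicate (p - 1) (0\<^sub>m m n)" and ?C = "map ((*) M) B"
  have A: "?A \<in> tensor_carrier m n p"
    using p M by (auto simp: tensor_carrier_def)
  have C: "?C \<in> tensor_carrier m q p"
    using M B by (auto simp: tensor_carrier_def)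
  note dA = tensor_carrierD[OF A] and dB = tensor_carrierD[OF B] and dC = tensor_carrierD[OF C]
  have "bcirc ?C = bcirc ?A * bcirc B"
  proof (rule eq_matI)
    fix r c assume "r < dim_row (bcirc ?A * bcirc B)" "c < dim_col (bcirc ?A * bcirc B)"
    then have r: "r < m * p" and c: "c < q * p"
      using dA dB p by (auto simp: bcirc_def Let_def)
    define R S where "R = r div m" and "S = c div q"
    have mq: "m > 0" "q > 0" using r c by (auto intro: Nat.gr0I)
    have R: "R < p" and S: "S < p"
      using r c by (auto simp: R_def S_def less_mult_imp_div_less mult.commute)
    let ?f = "\<lambda>x. (?A ! ((R + p - x div n) mod p)) $$ (r mod m, x mod n)
      * (B ! ((x div n + p - S) mod p)) $$ (x mod n, c mod q)"
    have "(bcirc ?A * bcirc B) $$ (r, c) = sum ?f {..<n * p}"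
      using r c dA dB p
      by (simp add: bcirc_def Let_def scalar_prod_def R_def S_def atLeast0LessThan)
    \<comment> \<open>The matrix \<open>bcirc ?A\<close> is block diagonal with every diagonal block
      equal to \<open>M\<close>, so in block row \<open>R\<close> only the columns of block
      \<open>R\<close> contribute.\<close>
    also have "\<dots> = sum ?f {R * n..<R * n + n}"
    proof (rule sum.mono_neutral_right)
      have "R * n + n \<le> n * p"
        using R by (metis Suc_leI add.commute mult.commute mult_Suc mult_le_mono1)
      then show "{R * n..<R * n + n} \<subseteq> {..<n * p}" by auto
      show "\<forall>x\<in>{..<n * p} - {R * n..<R * n + n}. ?f x = 0"
      proof
        fix x assume x: "x \<in> {..<n * p} - {R * n..<R * n + n}"
        then have n: "n > 0" by (auto intro: Nat.gr0I)
        have L: "x div n < p" using x by (simp add: less_mult_imp_div_less mult.commute)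
        have "x div n \<noteq> R"
          using x div_times_less_eq_dividend[of x n] dividend_less_div_times[OF n, of x] by auto
        \<comment> \<open>Two distinct block indices below \<open>p\<close> are not congruent modulo
          \<open>p\<close>, so the slice selected is one of the zero slices.\<close>
        then have "(R + p - x div n) mod p \<noteq> 0"
          using R L by (cases "x div n \<le> R") (auto simp: le_mod_geq)
        moreover have "(R + p - x div n) mod p < p" using p by simp
        \<comment> \<open>Positivity of \<open>m\<close> and \<open>n\<close> puts the entry inside
          the zero slice, where its value is determined.\<close>
        ultimately show "?f x = 0" using mq n by (simp add: nth_Cons')
      qed
    qed simp
    also have "\<dots> = (\<Sum>t<n. ?f (R * n + t))"
      using sum.shift_bounds_nat_ivl[of ?f 0 "R * n" n] by (simp add: atLeast0LessThan add.commute)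
    also have "\<dots> = (\<Sum>t<n. M $$ (r mod m, t) * (B ! ((R + p - S) mod p)) $$ (t, c mod q))"
    proof (rule sum.cong[OF refl])
      fix t assume "t \<in> {..<n}"
      then have "(R * n + t) div n = R" "(R * n + t) mod n = t" by auto
      then show "?f (R * n + t) = M $$ (r mod m, t) * (B ! ((R + p - S) mod p)) $$ (t, c mod q)"
        by (simp only:) simp
    qed
    also have "\<dots> = (?C ! ((R + p - S) mod p)) $$ (r mod m, c mod q)"
      using p mq M dB by (simp add: scalar_prod_def atLeast0LessThan)
    also have "\<dots> = bcirc ?C $$ (r, c)"
      using r c dC p by (simp add: bcirc_def Let_def R_def S_def)
    finally show "bcirc ?C $$ (r, c) = (bcirc ?A * bcirc B) $$ (r, c)" by simp
  qed (use dA dB dC p in \<open>auto simp: bcirc_def Let_def\<close>)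
  \<comment> \<open>The identity of block circulants identifies \<open>?C\<close> with the
    T-product, because the tensor in its definite description is unique.\<close>
  then show ?thesis
    unfolding t_product_def using t_product_ex1[OF p A B] C dA dB p
    by (intro the1_equality) auto
qed

section \<open>Fourier-domain slices of products and adjoints\<close>

lemma fourier_slice_carrier:
  assumes "A \<in> tensor_carrier m n p" "p \<ge> 1"
  shows "fourier_slice A i \<in> carrier_mat m n"
  using tensor_carrierD[OF assms(1)] assms(2) by (simp add: fourier_slice_def Let_def)

text \<open>A Fourier-domain slice is a linear combination of frontal slices, so a constant left
  factor comes out of it; entrywise this is an exchange of two finite sums.\<close>

lemma fourier_slice_map_mult:
  assumes p: "p \<ge> 1" and M: "M \<in> carrier_mat m n" and B: "B \<in> tensor_carrier n q p"
  shows "fourier_slice (map ((*) M) B) i = M * fourier_slice B i"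
proof (rule eq_matI)
  have C: "map ((*) M) B \<in> tensor_carrier m q p"
    using M B by (auto simp: tensor_carrier_def)
  note dB = tensor_carrierD[OF B] and dC = tensor_carrierD[OF C]
  fix r c assume "r < dim_row (M * fourier_slice B i)" "c < dim_col (M * fourier_slice B i)"
  then have r: "r < m" and c: "c < q" using M fourier_slice_carrier[OF B p, of i] by auto
  define \<omega> :: complex where "\<omega> = exp (2 * of_real pi * \<i> / of_nat p)"
  have "fourier_slice (map ((*) M) B) i $$ (r, c) =
      (\<Sum>j<p. \<Sum>t<n. \<omega> ^ (i * j) * (M $$ (r, t) * (B ! j) $$ (t, c)))"
    using r c p M dB dC
    by (simp add: fourier_slice_def Let_def \<omega>_def[symmetric] scalar_prod_def atLeast0LessThan
        sum_distrib_left)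
  also have "\<dots> = (\<Sum>t<n. M $$ (r, t) * (\<Sum>j<p. \<omega> ^ (i * j) * (B ! j) $$ (t, c)))"
    by (subst sum.swap) (simp add: sum_distrib_left mult.left_commute)
  also have "\<dots> = (M * fourier_slice B i) $$ (r, c)"
    using r c p M dB
    by (simp add: fourier_slice_def Let_def \<omega>_def[symmetric] scalar_prod_def atLeast0LessThan)
  finally show "fourier_slice (map ((*) M) B) i $$ (r, c) = (M * fourier_slice B i) $$ (r, c)" .
next
  have C: "map ((*) M) B \<in> tensor_carrier m q p"
    using M B by (auto simp: tensor_carrier_def)
  show "dim_row (fourier_slice (map ((*) M) B) i) = dim_row (M * fourier_slice B i)"
    "dim_col (fourier_slice (map ((*) M) B) i) = dim_col (M * fourier_slice B i)"
    using fourier_slice_carrier[OF C p, of i] fourier_slice_carrier[OF B p, of i] M by auto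
qed

lemma t_adjoint_carrier:
  assumes "A \<in> tensor_carrier m n p"
  shows "t_adjoint A \<in> tensor_carrier n m p"
  using tensor_carrierD[OF assms]
  by (auto simp: tensor_carrier_def t_adjoint_def intro!: mat_adjoint_carrier)

text \<open>Reduction modulo the length absorbs the special case \<open>k = 0\<close>, so the
  reordering of slices becomes negation of indices modulo \<open>p\<close>.\<close>

lemma t_adjoint_nth:
  assumes "k < length A"
  shows "t_adjoint A ! k = mat_adjoint (A ! ((length A - k) mod length A))"
  using assms by (simp add: t_adjoint_def)

text \<open>Negation modulo \<open>p\<close> is its own inverse; the outer \<open>mod\<close>
  matters only at \<open>j = 0\<close>, where it sends \<open>p\<close> back to
  \<open>0\<close>.\<close>

lemma bij_betw_neg_mod: "bij_betw (\<lambda>j. (p - j) mod p) {..<p} {..<p :: nat}"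
proof (rule bij_betw_byWitness[where f' = "\<lambda>j. (p - j) mod p"])
  have "(p - (p - j) mod p) mod p = j" if "j < p" for j
    using that by (cases "j = 0") auto
  then show "\<forall>j\<in>{..<p}. (p - (p - j) mod p) mod p = j" "\<forall>j\<in>{..<p}. (p - (p - j) mod p) mod p = j"
    by auto
qed auto

text \<open>On the unit circle conjugation is inversion, and \<open>\<omega> ^ p = 1\<close> makes
  the inverse of a power of \<open>\<omega>\<close> the power with negated exponent modulo
  \<open>p\<close>.\<close>

lemma cnj_root_unity_power:
  assumes "j < p"
  defines "\<omega> \<equiv> exp (2 * of_real pi * \<i> / of_nat p)"
  shows "cnj (\<omega> ^ (i * j)) = \<omega> ^ (i * ((p - j) mod p))"
proof (cases "j = 0")
  case False
  have w: "\<omega> = cis (2 * pi / real p)"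
    by (simp add: \<omega>_def cis_conv_exp field_simps)
  have "\<omega> ^ p = 1" using assms(1) by (simp add: w DeMoivre)
  then have "\<omega> ^ (i * j) * \<omega> ^ (i * (p - j)) = 1"
    using assms(1)
    by (metis add_mult_distrib2 le_add_diff_inverse less_imp_le mult.commute power_add power_mult
        power_one)
  then have "\<omega> ^ (i * (p - j)) = inverse (\<omega> ^ (i * j))"
    by (simp add: inverse_unique)
  also have "\<dots> = cnj (\<omega> ^ (i * j))"
    by (simp add: w cis_cnj cis_inverse[symmetric] power_inverse del: cis_inverse)
  finally show ?thesis using False assms(1) by simp
qed simp

text \<open>Conjugation replaces \<open>\<omega>\<close> by its inverse, which negates the summation
  index modulo \<open>p\<close>; the reordering of slices in \<open>t_adjoint\<close> undoes exactly
  this.\<close>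

lemma fourier_slice_t_adjoint:
  assumes p: "p \<ge> 1" and A: "A \<in> tensor_carrier m n p"
  shows "fourier_slice (t_adjoint A) i = mat_adjoint (fourier_slice A i)"
proof (rule eq_matI)
  note dA = tensor_carrierD[OF A] and dT = tensor_carrierD[OF t_adjoint_carrier[OF A]]
  fix r c
  assume "r < dim_row (mat_adjoint (fourier_slice A i))" "c < dim_col (mat_adjoint (fourier_slice A i))"
  then have r: "r < n" and c: "c < m"
    using fourier_slice_carrier[OF A p, of i] by (auto simp: dim_mat_adjoint)
  define \<omega> :: complex where "\<omega> = exp (2 * of_real pi * \<i> / of_nat p)"
  let ?g = "\<lambda>j. cnj (\<omega> ^ (i * j)) * cnj ((A ! j) $$ (c, r))"
  have "mat_adjoint (fourier_slice A i) $$ (r, c) = (\<Sum>j<p. ?g j)"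
    using r c p dA fourier_slice_carrier[OF A p, of i]
    by (simp add: index_mat_adjoint fourier_slice_def Let_def \<omega>_def[symmetric])
  also have "\<dots> = (\<Sum>j<p. ?g ((p - j) mod p))"
    by (rule sum.reindex_bij_betw[OF bij_betw_neg_mod, symmetric])
  also have "\<dots> = (\<Sum>j<p. \<omega> ^ (i * j) * (t_adjoint A ! j) $$ (r, c))"
  proof (rule sum.cong[OF refl])
    fix j assume "j \<in> {..<p}"
    then have j: "j < p" by simp
    \<comment> \<open>The second fact, double negation, restores the exponent \<open>i * j\<close>
      after the conjugate of the root is rewritten.\<close>
    then have k: "(p - j) mod p < p" "(p - (p - j) mod p) mod p = j"
      by (cases "j = 0"; simp)+
    show "?g ((p - j) mod p) = \<omega> ^ (i * j) * (t_adjoint A ! j) $$ (r, c)"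
      using cnj_root_unity_power[OF k(1), of i] k j r c dA
      by (simp add: t_adjoint_nth index_mat_adjoint \<omega>_def del: complex_cnj_power)
  qed
  also have "\<dots> = fourier_slice (t_adjoint A) i $$ (r, c)"
    using r c p dT by (simp add: fourier_slice_def Let_def \<omega>_def)
  finally show "fourier_slice (t_adjoint A) i $$ (r, c) = mat_adjoint (fourier_slice A i) $$ (r, c)"
    by simp
qed (use fourier_slice_carrier[OF A p, of i] fourier_slice_carrier[OF t_adjoint_carrier[OF A] p, of i]
    in \<open>auto simp: dim_mat_adjoint\<close>)

section \<open>The T-Hamiltonian condition slice by slice\<close>

lemma T_Hamiltonian_iff_fourier_slices:
  assumes p: "p \<ge> 1" and H: "H \<in> tensor_carrier (2 * n) (2 * n) p"
  shows "T_Hamiltonian n p H \<longleftrightarrow> (\<forall>i<p. hermitian_mat (J_mat n * fourier_slice H i))"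
proof -
  \<comment> \<open>This is the product of \<open>J_tensor n p\<close> and \<open>H\<close> in
    explicit form, free of definite descriptions.\<close>
  define G where "G = map ((*) (J_mat n)) H"
  have G: "G \<in> tensor_carrier (2 * n) (2 * n) p"
    using H J_mat_carrier[of n] by (auto simp: tensor_carrier_def G_def)
  have "T_Hamiltonian n p H \<longleftrightarrow> t_adjoint G = G"
    unfolding T_Hamiltonian_def J_tensor_eq[OF p] t_product_single_slice[OF p J_mat_carrier H] G_def
    using H by simp
  also have "\<dots> \<longleftrightarrow> (\<forall>i<p. fourier_slice (t_adjoint G) i = fourier_slice G i)"
    using fourier_slice_inj[OF p t_adjoint_carrier[OF G] G] by auto
  also have "\<dots> \<longleftrightarrow> (\<forall>i<p. hermitian_mat (J_mat n * fourier_slice H i))"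
    unfolding fourier_slice_t_adjoint[OF p G] hermitian_mat_def
    unfolding G_def fourier_slice_map_mult[OF p J_mat_carrier H] ..
  finally show ?thesis .
qed

theorem proposition3p5:
  fixes n p :: nat and H :: tensor
  assumes "n \<ge> 1" and "p \<ge> 1"
    and "H \<in> tensor_carrier (2 * n) (2 * n) p"
  shows "T_Hamiltonian n p H \<longleftrightarrow>
    (\<forall>i<p. \<exists>A B C.
        A \<in> carrier_mat n n \<and> B \<in> carrier_mat n n \<and> C \<in> carrier_mat n n \<and>
        hermitian_mat B \<and> hermitian_mat C \<and>
        fourier_slice H i = four_block_mat A B C (- mat_adjoint A))"
  unfolding T_Hamiltonian_iff_fourier_slices[OF assms(2,3)]
    hermitian_J_mat_mult_iff[OF fourier_slice_carrier[OF assms(3,2)]] ..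

end
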